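(* Let $v_h,w_h\in\mathbb{V}_h$ be such that $$\mathcal{L}_h[v_h](x_i)\ge\mathcal{L}_h[w_h](x_i)\qquad\forall x_i\in\mathcal{N}_h^0.$$ Then $v_h\ge w_h$ in $\Omega$.
   Context: Let $n\ge1$, $s\in(0,1)$, and let $\Omega\subset\mathbb{R}^n$ be a bounded Lipschitz open polytope satisfying the exterior ball condition (there is $r>0$ such that every $x\in\partial\Omega$ lies in the closure of an open ball of radius $r$ contained in $\Omega^c:=\mathbb{R}^n\setminus\Omega$). $\mathcal{T}_h$ is a conforming simplicial triangulation of $\Omega$, $\mathcal{N}_h^0$ is the set of its nodes (vertices) not lying on $\partial\Omega$. $\mathbb{V}_h$ is the space of continuous functions on $\mathbb{R}^n$ that are affine on each $T\in\mathcal{T}_h$ and vanish in $\Omega^c$. For each $x_i\in\mathcal{N}_h^0$ a scale $H_i>0$ with $B_{H_i}(x_i)\subset\Omega$ is given, together with an open star-shaped set $\Omega_i=\{x_i+\rho\theta:\theta\in S^{n-1},\ 0\le\rho<\rho_i(\theta)\}\subset\Omega$, $\rho_i(\theta)>0$, such that (symmetry) $x_i+(z_1,\dots,z_n)\in\Omega_i$ iff $x_i+(\pm z_{\sigma(1)},\dots,\pm z_{\sigma(n)})\in\Omega_i$ for all signs and all permutations $\sigma$, and (quasi-uniformity) $\underline c_SH_i\le\rho_i(\theta)\le\bar c_SH_i$ for all $\theta\in S^{n-1}$, with positive constants $\underline c_S,\bar c_S$. Set $\kappa_{n,s,i}:=\frac1{4n(1-s)}\int_{S^{n-1}}(\rho_i(\theta)/H_i)^{2-2s}\,dS_\theta$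 and $$\mathcal{L}_h[v](x_i):=-\kappa_{n,s,i}\sum_{j=1}^n\frac{v(x_i+H_ie_j)-2v(x_i)+v(x_i-H_ie_j)}{H_i^{2s}}+\int_{\mathbb{R}^n\setminus\Omega_i}\frac{v(x_i)-v(y)}{|x_i-y|^{n+2s}}\,dy.$$ *)

theory Defs
  imports "HOL-Analysis.Analysis"
begin

text \<open>A polytope here need not be convex: it is the interior of a finite union of the library's
  (convex, compact) polytopes.\<close>

definition open_polytope :: "'a::euclidean_space set \<Rightarrow> bool" where
  "open_polytope \<Omega> \<longleftrightarrow>
     (\<exists>F. finite F \<and> (\<forall>P\<in>F. polytope P) \<and> \<Omega> = interior (\<Union>F))"

lemma open_polytope_imp_open: "open_polytope \<Omega> \<Longrightarrow> open \<Omega>"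
  by (auto simp: open_polytope_def)

lemma open_polytope_imp_bounded: "open_polytope \<Omega> \<Longrightarrow> bounded \<Omega>"
  unfolding open_polytope_def
  by (meson bounded_Union bounded_subset interior_subset polytope_imp_bounded)

text \<open>Near each boundary point, \<open>\<Omega>\<close> is the strict epigraph, in the direction \<open>\<nu>\<close>, of a
  Lipschitz function \<open>\<phi>\<close> on the hyperplane through the origin orthogonal to \<open>\<nu>\<close>.\<close>

definition lipschitz_domain :: "'a::euclidean_space set \<Rightarrow> bool" where
  "lipschitz_domain \<Omega> \<longleftrightarrow> open \<Omega> \<and>
     (\<forall>x\<in>frontier \<Omega>. \<exists>\<nu> \<delta> L \<phi>. norm \<nu> = 1 \<and> \<delta> > 0 \<and>
        L-lipschitz_on {z. z \<bullet> \<nu> = 0} \<phi> \<and>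
        (\<forall>y\<in>ball x \<delta>. y \<in> \<Omega> \<longleftrightarrow> \<phi> (y - (y \<bullet> \<nu>) *\<^sub>R \<nu>) < y \<bullet> \<nu>))"

definition exterior_ball_condition :: "'a::euclidean_space set \<Rightarrow> bool" where
  "exterior_ball_condition \<Omega> \<longleftrightarrow>
     (\<exists>r>0. \<forall>x\<in>frontier \<Omega>. \<exists>c. ball c r \<subseteq> - \<Omega> \<and> x \<in> closure (ball c r))"

text \<open>The elements are closed simplices of full dimension; conformity (any two elements meet in a
  possibly empty common face) is part of the library's \<^const>\<open>triangulation\<close>.\<close>

definition conforming_mesh :: "'a::euclidean_space set \<Rightarrow> 'a set set \<Rightarrow> bool" where
  "conforming_mesh \<Omega> \<T> \<longleftrightarrow>
     triangulation \<T> \<and> (\<forall>T\<in>\<T>. int DIM('a) simplex T) \<and> \<Union>\<T> = closure \<Omega>"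

definition interior_nodes :: "'a::euclidean_space set \<Rightarrow> 'a set set \<Rightarrow> 'a set" where
  "interior_nodes \<Omega> \<T> = {x. \<exists>T\<in>\<T>. x extreme_point_of T} - frontier \<Omega>"

definition fe_space :: "'a::euclidean_space set \<Rightarrow> 'a set set \<Rightarrow> ('a \<Rightarrow> real) set" where
  "fe_space \<Omega> \<T> = {v. continuous_on UNIV v \<and>
     (\<forall>T\<in>\<T>. \<exists>g b. linear g \<and> (\<forall>x\<in>T. v x = g x + b)) \<and>
     (\<forall>x. x \<notin> \<Omega> \<longrightarrow> v x = 0)}"

definition star_set :: "'a::euclidean_space \<Rightarrow> ('a \<Rightarrow> real) \<Rightarrow> 'a set" where
  "star_set x \<rho> = {x + t *\<^sub>R \<theta> | t \<theta>. \<theta> \<in> sphere 0 1 \<and> 0 \<le> t \<and> t < \<rho> \<theta>}"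

definition symmetric_about :: "real ^ 'n \<Rightarrow> (real ^ 'n) set \<Rightarrow> bool" where
  "symmetric_about x S \<longleftrightarrow>
     (\<forall>\<sigma> \<epsilon> z. \<sigma> permutes UNIV \<and> (\<forall>j. \<epsilon> j \<in> {-1, 1}) \<longrightarrow>
        (x + z \<in> S \<longleftrightarrow> x + (\<chi> j. \<epsilon> j * z $ \<sigma> j) \<in> S))"

text \<open>Surface measure \<open>dS\<close> on the unit sphere: the measure of \<open>A\<close> is the dimension times the
  Lebesgue measure of the cone \<open>{t \<theta> | \<theta> \<in> A, 0 < t \<le> 1}\<close>, which is the normalisation that
  makes polar coordinates read \<open>dy = t ^ (n - 1) dt dS\<close>.\<close>

definition sphere_measure :: "'a::euclidean_space measure" where
  "sphere_measure = scale_measure (of_nat DIM('a))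
     (distr (restrict_space lborel (cball 0 1 - {0})) (restrict_space borel (sphere 0 1)) sgn)"

lemma emeasure_sphere_measure:
  fixes A :: "'a::euclidean_space set"
  assumes "A \<in> sets borel" "A \<subseteq> sphere 0 1"
  shows "emeasure sphere_measure A =
    of_nat DIM('a) * emeasure lborel {x \<in> cball 0 1 - {0}. sgn x \<in> A}"
proof -
  have *: "(sgn :: 'a \<Rightarrow> 'a) \<in> restrict_space lborel (cball 0 1 - {0}) \<rightarrow>\<^sub>M
            restrict_space borel (sphere 0 1)"
    by (rule measurable_restrict_space2)
       (auto simp: space_restrict_space norm_sgn sgn_div_norm[abs_def] intro!: measurable_restrict_space1)
  have "A \<in> sets (restrict_space borel (sphere 0 1))"
    using assms by (simp add: sets_restrict_space_iff)
  then have "emeasure sphere_measure A = of_nat DIM('a) *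
      emeasure (restrict_space lborel (cball 0 1 - {0})) {x \<in> cball 0 1 - {0}. sgn x \<in> A}"
    unfolding sphere_measure_def
    by (simp add: emeasure_distr[OF *] space_restrict_space vimage_def Int_def conj_commute)
  then show ?thesis
    by (subst (asm) emeasure_restrict_space) auto
qed

definition kappa :: "real \<Rightarrow> real \<Rightarrow> (real ^ 'n \<Rightarrow> real) \<Rightarrow> real" where
  "kappa s H \<rho> = 1 / (4 * real CARD('n) * (1 - s)) *
     (\<integral>\<theta>. (\<rho> \<theta> / H) powr (2 - 2 * s) \<partial>sphere_measure)"

definition Lh :: "real \<Rightarrow> real \<Rightarrow> (real ^ 'n \<Rightarrow> real) \<Rightarrow> (real ^ 'n \<Rightarrow> real) \<Rightarrow> real ^ 'n \<Rightarrow> real" where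
  "Lh s H \<rho> v x =
     - kappa s H \<rho> * (\<Sum>j\<in>UNIV.
         (v (x + H *\<^sub>R axis j 1) - 2 * v x + v (x - H *\<^sub>R axis j 1)) / H powr (2 * s))
     + (LINT y:(- star_set x \<rho>)|lborel. (v x - v y) / norm (x - y) powr (real CARD('n) + 2 * s))"

end

theory Submission
  imports Defs
begin

text \<open>
  The statement is a discrete comparison principle, and the reason for it is a discrete maximum
  principle: the operator is strictly negative at a negative global minimum.

  Put \<open>u = v - w\<close> and suppose that \<open>u\<close> is negative somewhere. Since \<open>u\<close> is continuous, vanishes
  off the bounded set \<open>\<Omega>\<close> and is affine on every element, its global minimum is attained at a vertex
  of an element (\<open>affine_extreme_point_le\<close>), and this vertex lies in \<open>\<Omega>\<close> because \<open>u\<close> does not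
  vanish there (\<open>fe_negative_minimum_at_interior_node\<close>). At this interior node both parts of the
  operator have a sign: the second differences of \<open>u\<close> are nonnegative and \<open>kappa\<close> is nonnegative,
  while the nonlocal integrand is nonpositive, and strictly negative outside the closure of \<open>\<Omega>\<close>,
  a set of positive measure. So the operator is strictly negative on \<open>u\<close>
  (\<open>Lh_negative_at_negative_minimum\<close>).

  By linearity (\<open>Lh_diff\<close>) this contradicts the hypothesis. The Bochner integral is linear only on
  integrable functions, so the nonlocal kernel has to be shown integrable away from its singularity
  (\<open>set_integrable_inverse_powr_outside_ball\<close>).
\<close>

section \<open>Integrability of the nonlocal kernel away from its singularity\<close>

text \<open>The kernel is dominated by a series of multiples of indicators of balls with dyadic radii:
  a point at distance between \<open>2 ^ k * r\<close> and \<open>2 ^ Suc k * r\<close> is covered by the \<open>k\<close>-th term. The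
  integral of the \<open>k\<close>-th term is a constant times the \<open>k\<close>-th power of \<open>2 ^ DIM('a) / 2 powr p\<close>,
  hence the series of the integrals is geometric and converges for \<open>p > DIM('a)\<close>.\<close>

lemma set_integrable_inverse_powr_outside_ball:
  fixes x :: "'a::euclidean_space"
  assumes r: "0 < r" and p: "real DIM('a) < p"
  shows "set_integrable lborel (- ball x r) (\<lambda>y. 1 / norm (x - y) powr p)"
proof -
  define a where "a k = 1 / (2 ^ k * r) powr p" for k :: nat
  define B where "B k = ball x (2 ^ Suc k * r)" for k :: nat
  define q where "q = 2 ^ DIM('a) / 2 powr p"
  define C where "C = unit_ball_vol DIM('a) * (2 * r) ^ DIM('a) / r powr p"
  have a_nonneg: "0 \<le> a k" for k
    by (simp add: a_def)
  have C_nonneg: "0 \<le> C"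
    using r by (simp add: C_def)
  have q: "0 \<le> q" "q < 1"
  proof -
    show "0 \<le> q" by (simp add: q_def)
    have "2 ^ DIM('a) = 2 powr real DIM('a)"
      by (simp add: powr_realpow)
    also have "\<dots> < 2 powr p"
      using p by simp
    finally show "q < 1"
      by (simp add: q_def)
  qed
  have term_integral: "(\<integral>\<^sup>+y. ennreal (a k) * indicator (B k) y \<partial>lborel) = ennreal (C * q ^ k)" for k
  proof -
    have "(\<integral>\<^sup>+y. ennreal (a k) * indicator (B k) y \<partial>lborel) = ennreal (a k) * emeasure lborel (B k)"
      by (simp add: B_def nn_integral_cmult_indicator)
    also have "\<dots> = ennreal (a k * (unit_ball_vol DIM('a) * (2 ^ Suc k * r) ^ DIM('a)))"
      using r a_nonneg by (simp add: B_def emeasure_ball ennreal_mult)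
    also have "a k * (unit_ball_vol DIM('a) * (2 ^ Suc k * r) ^ DIM('a)) = C * q ^ k"
    proof -
      have "(2 ^ k * r) powr p = (2 powr p) ^ k * r powr p"
        using r by (simp add: powr_mult powr_realpow[symmetric] powr_powr mult.commute)
      moreover have "((2::real) ^ Suc k * r) ^ DIM('a) = (2 * r) ^ DIM('a) * (2 ^ DIM('a)) ^ k"
        by (simp add: power_mult_distrib power_mult[symmetric] mult.commute)
      ultimately show ?thesis
        by (simp add: a_def C_def q_def power_divide mult_ac)
    qed
    finally show ?thesis .
  qed
  have dominated:
    "ennreal (norm (indicator (- ball x r) y *\<^sub>R (1 / norm (x - y) powr p)))
      \<le> (\<Sum>k. ennreal (a k) * indicator (B k) y)" (is "?L \<le> ?R") for y
  proof (cases "y \<in> ball x r")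
    case True
    then show ?thesis by simp
  next
    case False
    define t where "t = norm (x - y)"
    have t: "r \<le> t"
      using False by (simp add: t_def dist_norm)
    \<comment> \<open>The dyadic shell of \<open>y\<close>: the least exponent \<open>n\<close> with \<open>t < 2 ^ n * r\<close> is positive because
      \<open>r \<le> t\<close>, and its predecessor \<open>k\<close> indexes the term of the series that dominates at \<open>y\<close>.\<close>
    obtain N :: nat where "t / r < 2 ^ N"
      using real_arch_pow[of 2 "t / r"] by auto
    then have least: "t / r < 2 ^ (LEAST n. t / r < 2 ^ n)"
      by (rule LeastI)
    moreover have "\<not> t / r < 2 ^ 0"
      using t r by simp
    ultimately obtain k where k: "(LEAST n. t / r < 2 ^ n) = Suc k"
      by (metis not0_implies_Suc)
    then have "\<not> t / r < 2 ^ k"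
      by (metis lessI not_less_Least)
    then have lower: "2 ^ k * r \<le> t"
      using r by (simp add: pos_divide_less_eq not_less)
    have "t < 2 ^ Suc k * r"
      using least r unfolding k by (simp add: pos_divide_less_eq)
    then have "y \<in> B k"
      by (simp add: B_def t_def dist_norm)
    have "0 < t powr p * (2 ^ k * r) powr p"
      using t r by (intro mult_pos_pos) auto
    then have "1 / t powr p \<le> a k"
      unfolding a_def using lower r p by (intro divide_left_mono powr_mono2) auto
    then have "ennreal (1 / t powr p) \<le> ennreal (a k)"
      by (rule ennreal_leI)
    also have "\<dots> = ennreal (a k) * indicator (B k) y"
      unfolding indicator_simps(1)[OF \<open>y \<in> B k\<close>] by (rule mult_1_right[symmetric])
    finally have "ennreal (1 / t powr p) \<le> ennreal (a k) * indicator (B k) y" .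
    moreover have "?L = ennreal (1 / t powr p)"
      using False by (simp add: t_def)
    ultimately have "?L \<le> ennreal (a k) * indicator (B k) y"
      by (rule ord_eq_le_trans[rotated])
    also have "\<dots> = sum (\<lambda>k. ennreal (a k) * indicator (B k) y) {k}"
      by (simp only: sum.insert finite.emptyI empty_iff sum.empty add_0_right not_False_eq_True)
    also have "\<dots> \<le> ?R"
      by (intro sum_le_suminf summableI finite.intros zero_le)
    finally show ?thesis .
  qed
  have "(\<lambda>y. ennreal (a k) * indicator (B k) y) \<in> borel_measurable lborel" for k
    by (intro borel_measurable_times_ennreal borel_measurable_const borel_measurable_indicator)
      (simp add: B_def)
  then have "(\<integral>\<^sup>+y. (\<Sum>k. ennreal (a k) * indicator (B k) y) \<partial>lborel)
      = (\<Sum>k. \<integral>\<^sup>+y. ennreal (a k) * indicator (B k) y \<partial>lborel)"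
    by (rule nn_integral_suminf)
  then have total: "(\<integral>\<^sup>+y. (\<Sum>k. ennreal (a k) * indicator (B k) y) \<partial>lborel)
      = (\<Sum>k. ennreal (C * q ^ k))"
    unfolding term_integral .
  have "summable (\<lambda>k. C * q ^ k)"
    using q by (intro summable_mult summable_geometric) simp
  then have finite: "(\<Sum>k. ennreal (C * q ^ k)) = ennreal (\<Sum>k. C * q ^ k)"
    using q(1) C_nonneg by (intro suminf_ennreal2 mult_nonneg_nonneg zero_le_power)
  show ?thesis
    unfolding set_integrable_def
  proof (rule integrableI_bounded)
    have "(\<integral>\<^sup>+y. ennreal (norm (indicator (- ball x r) y *\<^sub>R (1 / norm (x - y) powr p))) \<partial>lborel)
        \<le> (\<integral>\<^sup>+y. (\<Sum>k. ennreal (a k) * indicator (B k) y) \<partial>lborel)"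
      by (intro nn_integral_mono dominated)
    then show "(\<integral>\<^sup>+y. ennreal (norm (indicator (- ball x r) y *\<^sub>R (1 / norm (x - y) powr p))) \<partial>lborel) < \<infinity>"
      unfolding total finite infinity_ennreal_def by (rule le_less_trans) (rule ennreal_less_top)
  qed measurable
qed

text \<open>An open set around \<open>x\<close> contains a ball around \<open>x\<close>, so on its complement the previous bound
  on the kernel applies, with the oscillation of \<open>u\<close> as a factor.\<close>

lemma set_integrable_difference_quotient:
  fixes u :: "'a::euclidean_space \<Rightarrow> real"
  assumes u: "continuous_on UNIV u" and bdd: "bounded (range u)"
    and S: "open S" "x \<in> S" and p: "real DIM('a) < p"
  shows "set_integrable lborel (- S) (\<lambda>y. (u x - u y) / norm (x - y) powr p)"
proof -
  obtain r where r: "0 < r" "ball x r \<subseteq> S"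
    using S by (auto simp: open_contains_ball)
  obtain M where M: "\<And>y. \<bar>u y\<bar> \<le> M"
    using bdd by (auto simp: bounded_iff)
  have meas [measurable]: "u \<in> borel_measurable borel" "S \<in> sets borel"
    using u S by (auto intro: borel_measurable_continuous_onI)
  have "set_integrable lborel (- S) (\<lambda>y. 1 / norm (x - y) powr p)"
    using set_integrable_subset[OF set_integrable_inverse_powr_outside_ball[OF r(1) p, of x],
      of "- S"] r(2) by auto
  then have "set_integrable lborel (- S) (\<lambda>y. 2 * M * (1 / norm (x - y) powr p))"
    by (rule set_integrable_mult_right)
  then show ?thesis
  proof (rule set_integrable_bound)
    show "set_borel_measurable lborel (- S) (\<lambda>y. (u x - u y) / norm (x - y) powr p)"
      unfolding set_borel_measurable_def by measurable
    have "\<bar>u x - u y\<bar> \<le> \<bar>2 * M\<bar>" for y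
      using M[of x] M[of y] by linarith
    then show "AE y in lborel. y \<in> - S \<longrightarrow> norm ((u x - u y) / norm (x - y) powr p)
        \<le> norm (2 * M * (1 / norm (x - y) powr p))"
      by (auto simp: abs_mult divide_right_mono)
  qed
qed

section \<open>The discrete operator\<close>

lemma centre_in_star_set:
  fixes x :: "real ^ 'n"
  assumes "\<And>\<theta>. \<theta> \<in> sphere 0 1 \<Longrightarrow> \<rho> \<theta> > 0"
  shows "x \<in> star_set x \<rho>"
proof -
  have "(axis undefined 1 :: real ^ 'n) \<in> sphere 0 1"
    by simp
  then show ?thesis
    using assms[of "axis undefined 1"] unfolding star_set_def
    by (intro CollectI exI[of _ 0] exI[of _ "axis undefined 1"]) auto
qed

lemma kappa_nonneg:
  assumes "s < 1"
  shows "0 \<le> kappa s H \<rho>"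
  using assms unfolding kappa_def by (intro mult_nonneg_nonneg Bochner_Integration.integral_nonneg) auto

text \<open>Linearity of the nonlocal part needs both integrals to converge. They do because the open
  star-shaped set around \<open>x\<close> keeps the domain of integration away from the singularity at \<open>x\<close>.\<close>

lemma Lh_diff:
  fixes v w :: "real ^ 'n \<Rightarrow> real"
  assumes "0 < s"
    and "continuous_on UNIV v" "bounded (range v)"
    and "continuous_on UNIV w" "bounded (range w)"
    and "open (star_set x \<rho>)" "x \<in> star_set x \<rho>"
  shows "Lh s H \<rho> (\<lambda>y. v y - w y) x = Lh s H \<rho> v x - Lh s H \<rho> w x"
proof -
  let ?q = "\<lambda>f y. (f x - f y) / norm (x - y) powr (real CARD('n) + 2 * s)"
  let ?d = "\<lambda>f j. (f (x + H *\<^sub>R axis j 1) - 2 * f x + f (x - H *\<^sub>R axis j 1)) / H powr (2 * s)"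
  have p: "real DIM(real ^ 'n) < real CARD('n) + 2 * s"
    using assms(1) by simp
  have "(LINT y:(- star_set x \<rho>)|lborel. ?q (\<lambda>y. v y - w y) y)
      = (LINT y:(- star_set x \<rho>)|lborel. ?q v y - ?q w y)"
    by (simp add: diff_divide_distrib[symmetric] algebra_simps)
  also have "\<dots> = (LINT y:(- star_set x \<rho>)|lborel. ?q v y) - (LINT y:(- star_set x \<rho>)|lborel. ?q w y)"
    using assms p by (intro set_integral_diff set_integrable_difference_quotient) auto
  finally have int: "(LINT y:(- star_set x \<rho>)|lborel. ?q (\<lambda>y. v y - w y) y) = \<dots>" .
  have "(\<Sum>j\<in>UNIV. ?d (\<lambda>y. v y - w y) j) = (\<Sum>j\<in>UNIV. ?d v j - ?d w j)"
    by (intro sum.cong refl) (simp add: diff_divide_distrib add_divide_distrib algebra_simps)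
  then have sum: "(\<Sum>j\<in>UNIV. ?d (\<lambda>y. v y - w y) j) = (\<Sum>j\<in>UNIV. ?d v j) - (\<Sum>j\<in>UNIV. ?d w j)"
    by (simp add: sum_subtractf)
  show ?thesis
    unfolding Lh_def int sum by (simp add: right_diff_distrib)
qed

text \<open>Strictness comes from the exterior of \<open>\<Omega>\<close>, where \<open>u\<close> vanishes and so exceeds its
  negative minimum by a fixed amount. Since \<open>\<Omega>\<close> is bounded, this exterior contains a nonempty open
  set, so that the integrand is nonzero on a set of positive measure.\<close>

lemma Lh_negative_at_negative_minimum:
  fixes u :: "real ^ 'n \<Rightarrow> real"
  assumes s: "0 < s" "s < 1"
    and \<Omega>: "bounded \<Omega>" "\<And>y. y \<notin> \<Omega> \<Longrightarrow> u y = 0"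
    and u: "continuous_on UNIV u" "bounded (range u)"
    and star: "open (star_set x \<rho>)" "x \<in> star_set x \<rho>" "star_set x \<rho> \<subseteq> \<Omega>"
    and min: "u x < 0" "\<And>y. u x \<le> u y"
  shows "Lh s H \<rho> u x < 0"
proof -
  let ?p = "real CARD('n) + 2 * s"
  define g where "g y = indicator (- star_set x \<rho>) y *\<^sub>R ((u x - u y) / norm (x - y) powr ?p)" for y
  have integrable: "integrable lborel g"
    using set_integrable_difference_quotient[OF u star(1,2), of ?p] s
    by (simp add: g_def[abs_def] set_integrable_def)
  have nonpos: "g y \<le> 0" for y
    using min(2)[of y] by (auto simp: g_def indicator_def divide_le_0_iff)
  have "integral\<^sup>L lborel g \<noteq> 0"
  proof
    assume "integral\<^sup>L lborel g = 0"
    then have "integral\<^sup>L lborel (\<lambda>y. - g y) = 0"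
      by simp
    then have "AE y in lborel. - g y = 0"
      using integral_nonneg_eq_0_iff_AE[of lborel "\<lambda>y. - g y"] integrable nonpos by auto
    moreover have "- g y \<noteq> 0" if "y \<in> - closure \<Omega>" for y
    proof -
      have y: "y \<notin> \<Omega>"
        using that closure_subset by blast
      then have "y \<notin> star_set x \<rho>" "x \<noteq> y"
        using star by auto
      then show ?thesis
        using \<Omega>(2)[OF y] min(1) by (simp add: g_def)
    qed
    ultimately have "AE y in lborel. y \<notin> - closure \<Omega>"
      by (auto elim: eventually_mono)
    then have "- closure \<Omega> \<in> null_sets lborel"
      by (subst AE_iff_null_sets) auto
    then have "negligible (- closure \<Omega>)"
      by (simp add: negligible_iff_null_sets null_sets_completionI)
    moreover have "- closure \<Omega> \<noteq> {}"
      using \<Omega>(1) bounded_closure not_bounded_UNIV by (metis Compl_empty_eq double_complement)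
    ultimately show False
      using open_not_negligible[of "- closure \<Omega>"] by auto
  qed
  moreover have "integral\<^sup>L lborel g \<le> 0"
    using Bochner_Integration.integral_nonneg[of lborel "\<lambda>y. - g y"] nonpos by simp
  ultimately have "(LINT y:(- star_set x \<rho>)|lborel. (u x - u y) / norm (x - y) powr ?p) < 0"
    unfolding set_lebesgue_integral_def g_def[abs_def] by linarith
  moreover have "0 \<le> (\<Sum>j\<in>UNIV.
      (u (x + H *\<^sub>R axis j 1) - 2 * u x + u (x - H *\<^sub>R axis j 1)) / H powr (2 * s))"
  proof (intro sum_nonneg divide_nonneg_nonneg)
    fix j
    show "0 \<le> u (x + H *\<^sub>R axis j 1) - 2 * u x + u (x - H *\<^sub>R axis j 1)"
      using min(2)[of "x + H *\<^sub>R axis j 1"] min(2)[of "x - H *\<^sub>R axis j 1"] by linarith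
  qed auto
  then have "0 \<le> kappa s H \<rho> * (\<Sum>j\<in>UNIV.
      (u (x + H *\<^sub>R axis j 1) - 2 * u x + u (x - H *\<^sub>R axis j 1)) / H powr (2 * s))"
    by (rule mult_nonneg_nonneg[OF kappa_nonneg[OF s(2)]])
  ultimately show ?thesis
    unfolding Lh_def by linarith
qed

section \<open>Minima of finite element functions\<close>

lemma fe_space_diff:
  assumes "v \<in> fe_space \<Omega> \<T>" "w \<in> fe_space \<Omega> \<T>"
  shows "(\<lambda>x. v x - w x) \<in> fe_space \<Omega> \<T>"
proof -
  have "\<exists>g b. linear g \<and> (\<forall>x\<in>T. v x - w x = g x + b)" if T: "T \<in> \<T>" for T
  proof -
    have aff: "\<exists>g b. linear g \<and> (\<forall>x\<in>T. f x = g x + b)" if "f \<in> fe_space \<Omega> \<T>" for f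
      using that T unfolding fe_space_def by simp
    obtain g b where g: "linear g" "\<forall>x\<in>T. v x = g x + b"
      using aff[OF assms(1)] by blast
    obtain g' b' where g': "linear g'" "\<forall>x\<in>T. w x = g' x + b'"
      using aff[OF assms(2)] by blast
    have "linear (\<lambda>x. g x - g' x)"
      using g(1) g'(1) by (rule linear_compose_sub)
    moreover have "\<forall>x\<in>T. v x - w x = g x - g' x + (b - b')"
      using g(2) g'(2) by simp
    ultimately show ?thesis
      by (intro exI conjI)
  qed
  moreover have "continuous_on UNIV (\<lambda>x. v x - w x)"
    using assms unfolding fe_space_def by (intro continuous_on_diff) simp_all
  moreover have "\<forall>x. x \<notin> \<Omega> \<longrightarrow> v x - w x = 0"
    using assms unfolding fe_space_def by simp
  ultimately show ?thesis
    unfolding fe_space_def by simp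
qed

lemma fe_space_bounded:
  assumes "v \<in> fe_space \<Omega> \<T>" "bounded \<Omega>"
  shows "bounded (range v)"
proof -
  have "compact (v ` closure \<Omega>)"
    using assms by (intro compact_continuous_image)
      (auto simp: fe_space_def compact_closure intro: continuous_on_subset)
  moreover have "range v \<subseteq> insert 0 (v ` closure \<Omega>)"
    using assms(1) closure_subset unfolding fe_space_def by fastforce
  ultimately show ?thesis
    by (meson bounded_insert bounded_subset compact_imp_bounded)
qed

text \<open>The points of \<open>T\<close> with value above \<open>u x\<close> form a convex set without \<open>x\<close>. By Krein and
  Milman, \<open>x\<close> is in the convex hull of the extreme points, so they cannot all be in that set.\<close>

lemma affine_extreme_point_le:
  fixes u :: "'a::euclidean_space \<Rightarrow> real"
  assumes T: "compact T" "convex T" and x: "x \<in> T"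
    and u: "linear g" "\<And>y. y \<in> T \<Longrightarrow> u y = g y + b"
  obtains e where "e extreme_point_of T" "u e \<le> u x"
proof -
  have "\<exists>e. e extreme_point_of T \<and> u e \<le> u x"
  proof (rule ccontr)
    assume "\<nexists>e. e extreme_point_of T \<and> u e \<le> u x"
    then have "{e. e extreme_point_of T} \<subseteq> g -` {g x<..}"
      using u(2) x by (force simp: extreme_point_of_def)
    moreover have "convex (g -` {g x<..})"
      using u(1) by (intro convex_linear_vimage) auto
    ultimately have "convex hull {e. e extreme_point_of T} \<subseteq> g -` {g x<..}"
      by (rule hull_minimal)
    then show False
      using x Krein_Milman_Minkowski[OF T] by auto
  qed
  then show ?thesis
    using that by blast
qed

text \<open>The minimum over the compact set \<open>closure \<Omega>\<close> is global since \<open>u\<close> is \<open>0\<close> elsewhere. It lies in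
  some element, where it is also attained at a vertex. That vertex is not on the boundary: the
  boundary of the open set \<open>\<Omega>\<close> is disjoint from \<open>\<Omega>\<close>, and \<open>u\<close> is \<open>0\<close> on it.\<close>

lemma fe_negative_minimum_at_interior_node:
  assumes \<Omega>: "open \<Omega>" "bounded \<Omega>" and mesh: "conforming_mesh \<Omega> \<T>"
    and u: "u \<in> fe_space \<Omega> \<T>" and neg: "x\<^sub>0 \<in> \<Omega>" "u x\<^sub>0 < 0"
  obtains e where "e \<in> interior_nodes \<Omega> \<T>" "u e < 0" "\<And>y. u e \<le> u y"
proof -
  have cont: "continuous_on UNIV u" and zero: "\<And>y. y \<notin> \<Omega> \<Longrightarrow> u y = 0"
    and aff: "\<And>T. T \<in> \<T> \<Longrightarrow> \<exists>g b. linear g \<and> (\<forall>x\<in>T. u x = g x + b)"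
    using u unfolding fe_space_def by auto
  have x\<^sub>0: "x\<^sub>0 \<in> closure \<Omega>"
    using neg(1) closure_subset by blast
  obtain z where z: "z \<in> closure \<Omega>" "\<And>y. y \<in> closure \<Omega> \<Longrightarrow> u z \<le> u y"
    using continuous_attains_inf[of "closure \<Omega>" u] \<Omega>(2) x\<^sub>0 cont
    by (metis compact_closure continuous_on_subset emptyE subset_UNIV)
  have z_neg: "u z < 0"
    using z(2)[OF x\<^sub>0] neg(2) by linarith
  have z_min: "u z \<le> u y" for y
    using z(2)[of y] z_neg zero[of y] closure_subset[of \<Omega>] by (cases "y \<in> \<Omega>") auto
  have "\<Union>\<T> = closure \<Omega>"
    using mesh unfolding conforming_mesh_def by blast
  then obtain T where T: "T \<in> \<T>" "z \<in> T"
    using z(1) by auto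
  then have "polytope T"
    using mesh simplex_imp_polytope unfolding conforming_mesh_def by blast
  moreover obtain g b where "linear g" "\<forall>x\<in>T. u x = g x + b"
    using aff[OF T(1)] by blast
  ultimately obtain e where e: "e extreme_point_of T" "u e \<le> u z"
    using affine_extreme_point_le[of T z g u b] T(2)
    by (auto simp: polytope_imp_compact polytope_imp_convex)
  have "u e < 0"
    using e(2) z_neg by linarith
  then have "e \<in> \<Omega>"
    using zero[of e] by force
  then have "e \<notin> frontier \<Omega>"
    using \<Omega>(1) by (simp add: frontier_def interior_open)
  then have "e \<in> interior_nodes \<Omega> \<T>"
    using e(1) T(1) unfolding interior_nodes_def by blast
  then show ?thesis
    using that \<open>u e < 0\<close> e(2) z_min order_trans by blast
qed

section \<open>The comparison principle\<close>

theorem lemma3p6: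
  fixes \<Omega> :: "(real ^ 'n) set"
    and \<T> :: "(real ^ 'n) set set"
    and s c\<^sub>1 c\<^sub>2 :: real
    and H :: "real ^ 'n \<Rightarrow> real"
    and \<rho> :: "real ^ 'n \<Rightarrow> real ^ 'n \<Rightarrow> real"
    and v w :: "real ^ 'n \<Rightarrow> real"
  assumes "0 < s" and "s < 1"
    and "open_polytope \<Omega>" and "lipschitz_domain \<Omega>" and "exterior_ball_condition \<Omega>"
    and "conforming_mesh \<Omega> \<T>"
    and "\<And>x. x \<in> interior_nodes \<Omega> \<T> \<Longrightarrow> H x > 0 \<and> ball x (H x) \<subseteq> \<Omega>"
    and "\<And>x \<theta>. x \<in> interior_nodes \<Omega> \<T> \<Longrightarrow> \<theta> \<in> sphere 0 1 \<Longrightarrow> \<rho> x \<theta> > 0"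
    and "\<And>x. x \<in> interior_nodes \<Omega> \<T> \<Longrightarrow>
           open (star_set x (\<rho> x)) \<and> star_set x (\<rho> x) \<subseteq> \<Omega>"
    and "\<And>x. x \<in> interior_nodes \<Omega> \<T> \<Longrightarrow> symmetric_about x (star_set x (\<rho> x))"
    and "c\<^sub>1 > 0" and "c\<^sub>2 > 0"
    and "\<And>x \<theta>. x \<in> interior_nodes \<Omega> \<T> \<Longrightarrow> \<theta> \<in> sphere 0 1 \<Longrightarrow>
           c\<^sub>1 * H x \<le> \<rho> x \<theta> \<and> \<rho> x \<theta> \<le> c\<^sub>2 * H x"
    and "v \<in> fe_space \<Omega> \<T>" and "w \<in> fe_space \<Omega> \<T>"
    and "\<And>x. x \<in> interior_nodes \<Omega> \<T> \<Longrightarrow>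
           Lh s (H x) (\<rho> x) v x \<ge> Lh s (H x) (\<rho> x) w x"
  shows "\<forall>x\<in>\<Omega>. v x \<ge> w x"
proof (rule ccontr)
  note \<Omega> = open_polytope_imp_open[OF assms(3)] open_polytope_imp_bounded[OF assms(3)]
  assume "\<not> (\<forall>x\<in>\<Omega>. v x \<ge> w x)"
  then obtain x\<^sub>0 where x\<^sub>0: "x\<^sub>0 \<in> \<Omega>" "v x\<^sub>0 - w x\<^sub>0 < 0"
    by force
  define u where "u = (\<lambda>x. v x - w x)"
  have u: "u \<in> fe_space \<Omega> \<T>"
    unfolding u_def using assms(14,15) by (rule fe_space_diff)
  obtain e where e: "e \<in> interior_nodes \<Omega> \<T>" "u e < 0" "\<And>y. u e \<le> u y"
    using fe_negative_minimum_at_interior_node[OF \<Omega> assms(6) u, of x\<^sub>0] x\<^sub>0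
    unfolding u_def by blast
  have star: "open (star_set e (\<rho> e))" "e \<in> star_set e (\<rho> e)" "star_set e (\<rho> e) \<subseteq> \<Omega>"
    using assms(9)[OF e(1)] centre_in_star_set[of "\<rho> e" e] assms(8)[OF e(1)] by auto
  have cont: "continuous_on UNIV f" and zero: "\<And>y. y \<notin> \<Omega> \<Longrightarrow> f y = 0"
    and bdd: "bounded (range f)" if "f \<in> fe_space \<Omega> \<T>" for f
    using that fe_space_bounded[OF that \<Omega>(2)] unfolding fe_space_def by auto
  have "Lh s (H e) (\<rho> e) u e < 0"
    by (rule Lh_negative_at_negative_minimum[OF assms(1,2) \<Omega>(2) zero[OF u] cont[OF u] bdd[OF u]
      star e(2,3)])
  moreover have "Lh s (H e) (\<rho> e) u e = Lh s (H e) (\<rho> e) v e - Lh s (H e) (\<rho> e) w e"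
    unfolding u_def using assms(1,14,15) star cont bdd by (intro Lh_diff) auto
  ultimately show False
    using assms(16)[OF e(1)] by linarith
qed

end
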